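(* Let $n\in\mathbb{N}$ and let $A,B\in M_n$ be such that $A$ is irreducible. The following statements are equivalent: (i) $\|A\otimes H+I\otimes K\|=\|B\otimes H+I\otimes K\|$ for all $H,K\in M_n$; (ii) $B=U^*AU$ for some unitary matrix $U\in M_n$.
   Context: $M_n$ denotes the set of $n\times n$ complex matrices, $X^*$ the conjugate transpose of $X$, and $I$ the identity matrix of $M_n$. A matrix $P\in M_n$ is a projection if $P^*=P$ and $P^2=P$. A matrix $X\in M_n$ is irreducible if $XP=PX$, for a projection $P\in M_n$, holds only if $P\in\{0,I\}$. The symbol $\otimes$ denotes the Kronecker (tensor) product, so that $M_n\otimes M_n$ is identified with the $n^2\times n^2$ complex matrices. The norm $\|\cdot\|$ is the spectral (operator) norm, $\|X\|=\sqrt{\mathrm{spr}(X^*X)}$, where $\mathrm{spr}$ denotes the spectral radius. *)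

theory Defs
  imports "HOL-Analysis.Analysis"
begin

definition conj_transpose :: "complex ^ 'n ^ 'm \<Rightarrow> complex ^ 'm ^ 'n" where
  "conj_transpose X = (\<chi> i j. cnj (X $ j $ i))"

definition projection_matrix :: "complex ^ 'n ^ 'n \<Rightarrow> bool" where
  "projection_matrix P \<longleftrightarrow> conj_transpose P = P \<and> P ** P = P"

definition irreducible_matrix :: "complex ^ 'n ^ 'n \<Rightarrow> bool" where
  "irreducible_matrix X \<longleftrightarrow>
     (\<forall>P. projection_matrix P \<longrightarrow> X ** P = P ** X \<longrightarrow> P = 0 \<or> P = mat 1)"

definition unitary_matrix :: "complex ^ 'n ^ 'n \<Rightarrow> bool" where
  "unitary_matrix U \<longleftrightarrow> conj_transpose U ** U = mat 1 \<and> U ** conj_transpose U = mat 1"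

(* Rows and columns are indexed by pairs, so for X, Y in M_n the product is a matrix
   with index type 'n * 'n of cardinality n^2: the block matrix (x_ij Y). *)
definition kronecker :: "complex ^ 'n ^ 'm \<Rightarrow> complex ^ 'l ^ 'k \<Rightarrow> complex ^ ('n \<times> 'l) ^ ('m \<times> 'k)"
    (infixl \<open>\<otimes>\<^sub>K\<close> 70) where
  "X \<otimes>\<^sub>K Y = (\<chi> p q. X $ fst p $ fst q * Y $ snd p $ snd q)"

definition eigenvalues :: "complex ^ 'n ^ 'n \<Rightarrow> complex set" where
  "eigenvalues X = {c. \<exists>v. v \<noteq> 0 \<and> X *v v = c *s v}"

(* The index type is finite and nonempty, so the spectrum is finite and nonempty
   and the maximum exists. *)
definition spectral_radius :: "complex ^ 'n ^ 'n \<Rightarrow> real" where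
  "spectral_radius X = Max (cmod ` eigenvalues X)"

(* Not the library's norm on complex ^ 'n ^ 'n, which is the Frobenius norm. *)
definition spectral_norm :: "complex ^ 'n ^ 'm \<Rightarrow> real" where
  "spectral_norm X = sqrt (spectral_radius (conj_transpose X ** X))"

end

theory Submission
  imports Defs
begin

text \<open>
  Identify \<open>\<complex>\<^sup>n \<otimes> \<complex>\<^sup>n\<close> with \<open>n \<times> n\<close> matrices under the Frobenius norm, so that \<open>A \<otimes> H + I \<otimes> K\<close>
  acts by \<open>V \<mapsto> A V H\<^sup>T + V K\<^sup>T\<close>. An operator \<open>L\<close> has positive real part iff \<open>\<parallel>L - t\<parallel>\<^sup>2 \<le> t\<^sup>2 + O(1)\<close>
  as \<open>t \<rightarrow> \<infinity>\<close>, hence (i) transfers positivity of the real part from the pencil of \<open>A\<close> to that of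
  \<open>B\<close> and back. By Hahn--Banach separation this says that \<open>B = \<Sum> V\<^sub>i\<^sup>* A V\<^sub>i\<close> and
  \<open>A = \<Sum> W\<^sub>j\<^sup>* B W\<^sub>j\<close> with \<open>\<Sum> V\<^sub>i\<^sup>* V\<^sub>i = \<Sum> W\<^sub>j\<^sup>* W\<^sub>j = I\<close>. The products \<open>V\<^sub>i W\<^sub>j\<close> are Kraus
  operators of a unital completely positive map fixing \<open>A\<close>. A finite-dimensional form of Arveson's
  boundary theorem shows that they are scalars, and then any nonzero \<open>W\<^sub>j\<close> is a multiple of a unitary
  implementing (ii).

  The boundary theorem rests on the equality case of the Kadison--Schwarz inequality, integrated
  against an invariant \<open>R\<close> of the dual map. Invariants of the form \<open>\<Sum> F\<^sub>j F\<^sub>j\<^sup>*\<close>, with \<open>F\<close> again fixing \<open>A\<close>,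
  come from Brouwer's theorem. Taking the map with \<open>\<Sum> E\<^sub>i E\<^sub>i\<^sup>*\<close> of minimal rank makes the range of
  \<open>R\<close> contain the ranges of all \<open>E\<^sub>i\<close>, so this range reduces \<open>A\<close> and is everything by irreducibility.
\<close>

notation conj_transpose (\<open>_\<^sup>\<dagger>\<close> [1000] 1000)

section \<open>Matrix algebra and the Frobenius inner product\<close>

text \<open>Bilinearity over the reals supplies the rules for sums, differences, real scaling and
  continuity cited in the later matrix computations.\<close>

interpretation matrix_mult: bounded_bilinear
  "(**) :: complex^'n^'m \<Rightarrow> complex^'p^'n \<Rightarrow> complex^'p^'m"
proof -
  have "bilinear ((**) :: complex^'n^'m \<Rightarrow> complex^'p^'n \<Rightarrow> complex^'p^'m)"
    unfolding bilinear_def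
    by (intro conjI allI linearI)
      (simp_all add: matrix_matrix_mult_def vec_eq_iff sum.distrib scaleR_sum_right
        distrib_left distrib_right)
  then show "bounded_bilinear ((**) :: complex^'n^'m \<Rightarrow> complex^'p^'n \<Rightarrow> complex^'p^'m)"
    by (simp add: bilinear_conv_bounded_bilinear)
qed

lemma bounded_linear_conj_transpose:
  "bounded_linear (conj_transpose :: complex^'n^'m \<Rightarrow> complex^'m^'n)"
proof -
  have "linear (conj_transpose :: complex^'n^'m \<Rightarrow> complex^'m^'n)"
    by (auto intro!: linearI simp: conj_transpose_def vec_eq_iff)
  then show ?thesis
    by (simp add: linear_conv_bounded_linear)
qed

lemmas conj_transpose_add = linear_add[OF bounded_linear.linear[OF bounded_linear_conj_transpose]]
  and conj_transpose_diff = linear_diff[OF bounded_linear.linear[OF bounded_linear_conj_transpose]]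
  and conj_transpose_sum = linear_sum[OF bounded_linear.linear[OF bounded_linear_conj_transpose]]
  and conj_transpose_scaleR = linear_scale[OF bounded_linear.linear[OF bounded_linear_conj_transpose]]
  and conj_transpose_zero = linear_0[OF bounded_linear.linear[OF bounded_linear_conj_transpose]]

lemma conj_transpose_conj_transpose [simp]: "X\<^sup>\<dagger>\<^sup>\<dagger> = X"
  by (simp add: conj_transpose_def vec_eq_iff)

lemma conj_transpose_mult: "(X ** Y)\<^sup>\<dagger> = Y\<^sup>\<dagger> ** X\<^sup>\<dagger>"
  by (simp add: conj_transpose_def matrix_matrix_mult_def vec_eq_iff mult.commute)

lemma conj_transpose_mat [simp]: "(mat c)\<^sup>\<dagger> = mat (cnj c)"
  by (simp add: conj_transpose_def mat_def vec_eq_iff)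

lemma inner_complex_mult_left: "inner (a * b) c = inner b (cnj a * c)" for a b c :: complex
  by (simp add: inner_complex_def algebra_simps)

text \<open>\<open>inner\<close> is the real part of the Hermitian form; moving an entry of
  \<open>X\<close> across it conjugates the entry, so its adjoint is still the conjugate
  transpose.\<close>

lemma inner_matrix_vector: "inner (X *v x) y = inner x (X\<^sup>\<dagger> *v y)"
  for X :: "complex^'n^'m"
proof -
  have "inner (X *v x) y = (\<Sum>i\<in>UNIV. \<Sum>j\<in>UNIV. inner (x $ j) (cnj (X $ i $ j) * y $ i))"
    by (simp add: inner_vec_def matrix_vector_mult_def inner_sum_left inner_complex_mult_left)
  also have "\<dots> = inner x (X\<^sup>\<dagger> *v y)"
    by (subst sum.swap)
      (simp add: inner_vec_def matrix_vector_mult_def inner_sum_right conj_transpose_def)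
  finally show ?thesis .
qed

lemma inner_matrix_mult_left: "inner (M ** X) Y = inner X (M\<^sup>\<dagger> ** Y)"
  for M :: "complex^'n^'m"
proof -
  have "inner (M ** X) Y
      = (\<Sum>i\<in>UNIV. \<Sum>k\<in>UNIV. \<Sum>j\<in>UNIV. inner (X $ j $ k) (cnj (M $ i $ j) * Y $ i $ k))"
    by (simp add: inner_vec_def matrix_matrix_mult_def inner_sum_left inner_complex_mult_left)
  also have "\<dots>
      = (\<Sum>j\<in>UNIV. \<Sum>k\<in>UNIV. \<Sum>i\<in>UNIV. inner (X $ j $ k) (cnj (M $ i $ j) * Y $ i $ k))"
    by (rule trans[OF sum.swap trans[OF sum.cong[OF refl sum.swap] sum.swap]])
  also have "\<dots> = inner X (M\<^sup>\<dagger> ** Y)"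
    by (simp add: inner_vec_def matrix_matrix_mult_def inner_sum_right conj_transpose_def)
  finally show ?thesis .
qed

lemma inner_conj_transpose: "inner X\<^sup>\<dagger> Y\<^sup>\<dagger> = inner X Y" for X :: "complex^'n^'m"
  unfolding inner_vec_def conj_transpose_def
  by (simp add: inner_complex_def) (rule sum.swap)

lemma inner_matrix_mult_right: "inner (X ** M) Y = inner X (Y ** M\<^sup>\<dagger>)"
  for M :: "complex^'n^'m"
proof -
  have "inner (X ** M) Y = inner (M\<^sup>\<dagger> ** X\<^sup>\<dagger>) Y\<^sup>\<dagger>"
    by (simp only: inner_conj_transpose flip: conj_transpose_mult)
  also have "\<dots> = inner X\<^sup>\<dagger> (Y ** M\<^sup>\<dagger>)\<^sup>\<dagger>"
    by (simp only: inner_matrix_mult_left conj_transpose_mult)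
  finally show ?thesis
    by (simp only: inner_conj_transpose)
qed

lemma mat_mult_left: "mat c ** X = (\<chi> i j. c * X $ i $ j)" for X :: "complex^'n^'m"
  by (simp add: mat_def matrix_matrix_mult_def vec_eq_iff if_distrib[of "\<lambda>x. x * _"] cong: if_cong)

lemma mat_mult_commute: "X ** mat c = mat c ** X" for X :: "complex^'n^'n"
  by (simp add: mat_def matrix_matrix_mult_def vec_eq_iff
      if_distrib[of "\<lambda>x. x * _"] if_distrib[of "\<lambda>x. _ * x"] mult.commute cong: if_cong)

lemma mat_of_real: "mat (of_real r) ** X = r *\<^sub>R X" for X :: "complex^'n^'m"
  unfolding mat_mult_left by (simp add: vec_eq_iff scaleR_conv_of_real[where 'a = complex])

lemma mat_mult_mat: "mat c ** mat d = (mat (c * d) :: complex^'n^'n)"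
  unfolding mat_mult_left by (simp add: mat_def vec_eq_iff)

lemma mat_diff: "mat c - mat d = (mat (c - d) :: complex^'n^'n)"
  by (simp add: mat_def vec_eq_iff)

lemma mat_1_neq_0: "(mat 1 :: complex^'n^'n) \<noteq> 0"
  by (metis matrix_vector_mul_lid matrix_vector_mult_0 zero_neq_one vec_eq_iff one_index zero_index)

section \<open>The spectral norm as an operator norm\<close>

text \<open>A nonzero linear term would dominate near \<open>t = 0\<close> and change sign there.
  Applied to a nonnegative quadratic form, this places its null vectors in the kernel.\<close>

lemma linear_coefficient_zero:
  fixes a b :: real
  assumes "\<And>t. 0 \<le> 2 * t * a + t\<^sup>2 * b"
  shows "a = 0"
proof (rule ccontr)
  assume a: "a \<noteq> 0"
  have b: "0 \<le> b"
    using assms[of 1] assms[of "-1"] by simp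
  \<comment> \<open>Nearly the minimiser \<open>- a / b\<close>; the shift by 1 keeps the
    denominator positive when \<open>b = 0\<close>.\<close>
  have "2 * (- a / (b + 1)) * a + (- a / (b + 1))\<^sup>2 * b = - (a\<^sup>2 * (b + 2)) / (b + 1)\<^sup>2"
    using b by (simp add: divide_simps power2_eq_square) (simp add: algebra_simps)
  also have "\<dots> < 0"
    using a b by (simp add: divide_neg_pos mult_pos_pos)
  finally show False
    using assms[of "- a / (b + 1)"] by simp
qed

text \<open>The norm of \<open>X *v v\<close> attains its maximum m on the compact unit sphere. The
  form m^2 |w|^2 - |Xw|^2 is then nonnegative and vanishes at the maximiser, which is therefore an
  eigenvector of the Gram matrix.\<close>

lemma max_singular_vector:
  fixes X :: "complex^'n^'m"
  obtains v where "norm v = 1" "\<And>w. norm (X *v w) \<le> norm (X *v v) * norm w"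
    "X\<^sup>\<dagger> *v (X *v v) = ((norm (X *v v))\<^sup>2) *\<^sub>R v"
proof -
  have scale: "X *v (c *\<^sub>R w) = c *\<^sub>R (X *v w)" for c w
    by (simp add: linear_scale)
  have "axis undefined 1 \<in> sphere (0 :: complex^'n) 1"
    by simp
  then have "sphere (0 :: complex^'n) 1 \<noteq> {}"
    by blast
  moreover have "continuous_on (sphere 0 1) (\<lambda>v. norm (X *v v))"
    by (intro continuous_intros linear_continuous_on) simp
  ultimately obtain v where v: "v \<in> sphere 0 1"
    and max: "\<And>w. w \<in> sphere 0 1 \<Longrightarrow> norm (X *v w) \<le> norm (X *v v)"
    using continuous_attains_sup[OF compact_sphere] by blast
  have bound: "norm (X *v w) \<le> norm (X *v v) * norm w" for w
  proof (cases "w = 0")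
    case False
    then have "norm (X *v (w /\<^sub>R norm w)) \<le> norm (X *v v)"
      by (intro max) simp
    with False show ?thesis
      by (simp add: scale field_simps)
  qed simp
  define r where "r = (norm (X *v v))\<^sup>2"
  define M where "M = (\<lambda>w. r *\<^sub>R w - X\<^sup>\<dagger> *v (X *v w))"
  have M_inner: "inner w (M u) = r * inner w u - inner (X *v w) (X *v u)" for w u
    unfolding M_def inner_matrix_vector by (simp add: inner_diff_right)
  have M_pos: "0 \<le> inner w (M w)" for w
    using power_mono[OF bound[of w], of 2]
    by (simp add: M_inner r_def power_mult_distrib power2_norm_eq_inner)
  have Mv: "inner v (M v) = 0"
    using v by (simp add: M_inner r_def power2_norm_eq_inner norm_eq_1)
  \<comment> \<open>Perturb \<open>v\<close> in the direction \<open>M v\<close>: the linear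
    coefficient of the form along this line is the squared norm of \<open>M v\<close>.\<close>
  have "inner (M v) (M v) = 0"
  proof (rule linear_coefficient_zero)
    fix t :: real
    have "inner (v + t *\<^sub>R M v) (M (v + t *\<^sub>R M v))
        = inner v (M v) + 2 * t * inner (M v) (M v) + t\<^sup>2 * inner (M v) (M (M v))"
      unfolding M_inner by (simp add: algebra_simps inner_simps power2_eq_square inner_commute
          scale M_inner)
    then show "0 \<le> 2 * t * inner (M v) (M v) + t\<^sup>2 * inner (M v) (M (M v))"
      using M_pos[of "v + t *\<^sub>R M v"] Mv by simp
  qed
  then have "X\<^sup>\<dagger> *v (X *v v) = r *\<^sub>R v"
    by (simp add: M_def)
  then show ?thesis
    using that[of v] v bound unfolding r_def by simp
qed

lemma inner_smult_left: "inner (c *s x) y = inner x (cnj c *s y)" for x y :: "complex^'n"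
  by (simp add: inner_vec_def inner_complex_mult_left)

lemma norm_smult: "norm (c *s x) = cmod c * norm x" for x :: "complex^'n"
  by (simp add: norm_vec_def norm_mult L2_set_right_distrib)

lemma smult_of_real: "of_real r *s x = r *\<^sub>R x" for x :: "complex^'n"
  by (simp add: vec_eq_iff scaleR_conv_of_real[where 'a = complex])

lemma matrix_vector_smult: "X *v (c *s x) = c *s (X *v x)" for X :: "complex^'n^'m"
  by (simp add: matrix_vector_mult_def vec_eq_iff sum_distrib_left mult.left_commute)

text \<open>Pairing with \<open>\<i> *s w\<close> isolates the imaginary part of \<open>c\<close>;
  the pairing vanishes because a vector and its multiple by \<open>\<i>\<close> are orthogonal for
  the real inner product.\<close>

lemma real_eigenvalue:
  fixes X :: "complex^'n^'m"
  assumes "X\<^sup>\<dagger> *v (X *v w) = c *s w" "w \<noteq> 0"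
  shows "Im c = 0"
proof -
  have "inner (\<i> *s w) (c *s w) = inner (X *v (\<i> *s w)) (X *v w)"
    by (simp add: inner_matrix_vector assms)
  also have "\<dots> = 0"
    unfolding matrix_vector_smult
    by (simp add: inner_vec_def inner_complex_def algebra_simps)
  finally have "inner (\<i> *s w) (c *s w) = 0" .
  moreover have "inner (\<i> *s w) (c *s w) = Im c * (norm w)\<^sup>2"
    unfolding power2_norm_eq_inner inner_vec_def sum_distrib_left
    by (rule sum.cong) (auto simp: inner_complex_def algebra_simps)
  ultimately show ?thesis
    using assms(2) by simp
qed

text \<open>Eigenvalues of a Gram matrix are real, so eigenvectors for distinct ones are orthogonal
  and hence independent. Finiteness makes the \<open>Max\<close> in \<open>spectral_radius\<close>
  meaningful.\<close>

lemma finite_eigenvalues_gram: "finite (eigenvalues (X\<^sup>\<dagger> ** X))" for X :: "complex^'n^'m"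
proof -
  let ?E = "eigenvalues (X\<^sup>\<dagger> ** X)"
  define f where "f c = (SOME v. v \<noteq> 0 \<and> (X\<^sup>\<dagger> ** X) *v v = c *s v)" for c
  have f: "f c \<noteq> 0" "X\<^sup>\<dagger> *v (X *v f c) = c *s f c" if "c \<in> ?E" for c
  proof -
    have "\<exists>v. v \<noteq> 0 \<and> (X\<^sup>\<dagger> ** X) *v v = c *s v"
      using that by (simp add: eigenvalues_def)
    from someI_ex[OF this] show "f c \<noteq> 0" "X\<^sup>\<dagger> *v (X *v f c) = c *s f c"
      unfolding f_def by (simp_all add: matrix_vector_mul_assoc)
  qed
  have inj: "inj_on f ?E"
    by (rule inj_onI) (metis f vector_mul_rcancel)
  have "orthogonal (f c) (f d)" if "c \<in> ?E" "d \<in> ?E" "c \<noteq> d" for c d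
  proof -
    have "inner (f c) (d *s f d) = inner (X *v f c) (X *v f d)"
      using f(2)[OF that(2)] by (simp add: inner_matrix_vector)
    also have "\<dots> = inner (X *v f d) (X *v f c)"
      by (rule inner_commute)
    also have "\<dots> = inner (f d) (c *s f c)"
      using f(2)[OF that(1)] by (simp add: inner_matrix_vector)
    also have "\<dots> = inner (c *s f c) (f d)"
      by (rule inner_commute)
    finally have eq: "inner (f c) (d *s f d) = inner (f c) (cnj c *s f d)"
      by (simp add: inner_smult_left)
    have c: "cnj c = of_real (Re c)" and d: "d = of_real (Re d)"
      using real_eigenvalue[OF f(2)[OF that(1)] f(1)[OF that(1)]]
        real_eigenvalue[OF f(2)[OF that(2)] f(1)[OF that(2)]]
      by (auto simp: complex_eq_iff)
    have "Re d * inner (f c) (f d) = Re c * inner (f c) (f d)"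
      using eq unfolding c by (subst (asm) d) (simp add: smult_of_real)
    moreover have "Re c \<noteq> Re d"
      using that(3) c d by (metis complex_cnj_cnj complex_cnj_complex_of_real)
    ultimately show ?thesis
      by (simp add: orthogonal_def)
  qed
  then have "pairwise orthogonal (f ` ?E)"
    by (auto simp: pairwise_def)
  moreover have "0 \<notin> f ` ?E"
    using f by auto
  ultimately have "independent (f ` ?E)"
    by (rule pairwise_orthogonal_independent)
  then have "finite (f ` ?E)"
    using independent_bound by blast
  then show ?thesis
    using inj by (rule finite_imageD)
qed

text \<open>The squared maximum m^2 of |Xv| on the unit sphere is an eigenvalue of the Gram matrix
  by \<open>max_singular_vector\<close>. No eigenvalue has larger modulus, since the bound m passes
  to the adjoint by Cauchy-Schwarz.\<close>

lemma spectral_norm_attained: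
  fixes X :: "complex^'n^'m"
  obtains v where "norm v = 1" "spectral_norm X = norm (X *v v)"
    "\<And>w. norm (X *v w) \<le> norm (X *v v) * norm w"
proof -
  obtain v where v: "norm v = 1" and bound: "\<And>w. norm (X *v w) \<le> norm (X *v v) * norm w"
    and eig: "X\<^sup>\<dagger> *v (X *v v) = ((norm (X *v v))\<^sup>2) *\<^sub>R v"
    using max_singular_vector[of X] by blast
  define m where "m = norm (X *v v)"
  have adj: "norm (X\<^sup>\<dagger> *v u) \<le> m * norm u" for u
  proof (cases "X\<^sup>\<dagger> *v u = 0")
    case False
    have "(norm (X\<^sup>\<dagger> *v u))\<^sup>2 = inner (X *v (X\<^sup>\<dagger> *v u)) u"
      by (simp add: inner_matrix_vector power2_norm_eq_inner)
    also have "\<dots> \<le> norm (X *v (X\<^sup>\<dagger> *v u)) * norm u"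
      by (rule norm_cauchy_schwarz)
    also have "\<dots> \<le> (m * norm (X\<^sup>\<dagger> *v u)) * norm u"
      unfolding m_def by (intro mult_right_mono bound) simp
    finally have "norm (X\<^sup>\<dagger> *v u) * norm (X\<^sup>\<dagger> *v u) \<le> (m * norm u) * norm (X\<^sup>\<dagger> *v u)"
      by (simp add: power2_eq_square mult_ac)
    with False show ?thesis
      by (simp add: mult_le_cancel_right)
  qed (simp add: m_def)
  have "cmod c \<le> m\<^sup>2" if "c \<in> eigenvalues (X\<^sup>\<dagger> ** X)" for c
  proof -
    obtain w where w: "w \<noteq> 0" "X\<^sup>\<dagger> *v (X *v w) = c *s w"
      using \<open>c \<in> _\<close> by (auto simp: eigenvalues_def matrix_vector_mul_assoc)
    have "cmod c * norm w = norm (X\<^sup>\<dagger> *v (X *v w))"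
      by (simp add: w norm_smult)
    also have "\<dots> \<le> m * (m * norm w)"
      using adj[of "X *v w"] mult_left_mono[OF bound[of w], of m] by (simp add: m_def)
    finally show ?thesis
      using w(1) by (simp add: power2_eq_square mult.assoc[symmetric] mult_le_cancel_right)
  qed
  moreover have "of_real (m\<^sup>2) \<in> eigenvalues (X\<^sup>\<dagger> ** X)"
    unfolding eigenvalues_def mem_Collect_eq
  proof (intro exI conjI)
    show "v \<noteq> 0"
      using v by auto
    show "(X\<^sup>\<dagger> ** X) *v v = of_real (m\<^sup>2) *s v"
      unfolding matrix_vector_mul_assoc[symmetric] eig m_def
      by (simp add: vec_eq_iff scaleR_conv_of_real[where 'a = complex])
  qed
  then have "m\<^sup>2 \<in> cmod ` eigenvalues (X\<^sup>\<dagger> ** X)"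
    by (rule rev_image_eqI) (simp del: of_real_power)
  ultimately have "spectral_radius (X\<^sup>\<dagger> ** X) = m\<^sup>2"
    unfolding spectral_radius_def using finite_eigenvalues_gram by (intro Max_eqI) auto
  then have "spectral_norm X = m"
    by (simp add: spectral_norm_def m_def)
  then show ?thesis
    using that[OF v] bound by (simp add: m_def)
qed

lemma spectral_norm_le_iff:
  fixes X :: "complex^'n^'m"
  assumes "0 \<le> c"
  shows "spectral_norm X \<le> c \<longleftrightarrow> (\<forall>v. norm (X *v v) \<le> c * norm v)"
proof -
  obtain v where "norm v = 1" "spectral_norm X = norm (X *v v)"
    "\<And>w. norm (X *v w) \<le> norm (X *v v) * norm w"
    using spectral_norm_attained by blast
  then show ?thesis
    by (metis mult.right_neutral mult_right_mono norm_ge_zero order_trans)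
qed

lemma spectral_norm_nonneg: "0 \<le> spectral_norm X" for X :: "complex^'n^'m"
  by (metis spectral_norm_attained norm_ge_zero)

section \<open>Vectorization and the pencil of a matrix\<close>

definition flatten :: "complex^'n^'m \<Rightarrow> complex^('m \<times> 'n)" where
  "flatten V = (\<chi> p. V $ fst p $ snd p)"

lemma surj_flatten: "\<exists>V. v = flatten V"
  by (rule exI[of _ "\<chi> i j. v $ (i, j)"]) (simp add: flatten_def vec_eq_iff)

lemma norm_flatten: "norm (flatten V) = norm V"
proof -
  have "inner (flatten V) (flatten V) = inner V V"
    by (simp add: inner_vec_def flatten_def sum.cartesian_product split_def UNIV_Times_UNIV)
  then show ?thesis
    by (simp add: norm_eq_sqrt_inner)
qed

text \<open>The usual vectorization identity, in row-major order. The second factor appears as a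
  plain transpose, without conjugation, because it acts linearly on the column index of
  \<open>V\<close>.\<close>

lemma kronecker_flatten: "(X \<otimes>\<^sub>K Y) *v flatten V = flatten (X ** V ** transpose Y)"
  for X Y :: "complex^'n^'n"
proof (unfold vec_eq_iff, rule allI)
  fix p :: "'n \<times> 'n"
  have "((X \<otimes>\<^sub>K Y) *v flatten V) $ p
      = (\<Sum>k\<in>UNIV. \<Sum>l\<in>UNIV. X $ fst p $ k * Y $ snd p $ l * V $ k $ l)"
    by (simp add: matrix_vector_mult_def kronecker_def flatten_def sum.cartesian_product
        split_def UNIV_Times_UNIV)
  also have "\<dots> = (\<Sum>l\<in>UNIV. \<Sum>k\<in>UNIV. X $ fst p $ k * Y $ snd p $ l * V $ k $ l)"
    by (rule sum.swap)
  also have "\<dots> = flatten (X ** V ** transpose Y) $ p"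
    by (simp add: matrix_matrix_mult_def flatten_def transpose_def sum_distrib_right
        sum_distrib_left mult_ac)
  finally show "((X \<otimes>\<^sub>K Y) *v flatten V) $ p = flatten (X ** V ** transpose Y) $ p" .
qed

lemma spectral_norm_pencil_le_iff:
  fixes A H K :: "complex^'n^'n"
  assumes "0 \<le> c"
  shows "spectral_norm (A \<otimes>\<^sub>K H + mat 1 \<otimes>\<^sub>K K) \<le> c
    \<longleftrightarrow> (\<forall>V. norm (A ** V ** transpose H + V ** transpose K) \<le> c * norm V)"
proof -
  have "(A \<otimes>\<^sub>K H + mat 1 \<otimes>\<^sub>K K) *v flatten V
      = flatten (A ** V ** transpose H + V ** transpose K)" for V
    by (simp add: matrix_vector_mult_add_rdistrib kronecker_flatten)
      (simp add: flatten_def vec_eq_iff)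
  then show ?thesis
    unfolding spectral_norm_le_iff[OF assms] by (metis surj_flatten norm_flatten)
qed

text \<open>Shift \<open>K\<close> by -t. Positivity for \<open>A\<close> bounds the shifted pencil
  by \<open>sqrt (M\<^sup>2 + t\<^sup>2)\<close>, the hypothesis carries this bound to
  \<open>B\<close>, and for large t it excludes a negative value of the form for
  \<open>B\<close>.\<close>

lemma positivity_transfer:
  fixes A B H K :: "complex^'n^'n"
  assumes norms: "\<And>(H :: complex^'n^'n) K c. 0 \<le> c
      \<Longrightarrow> \<forall>V. norm (A ** V ** H + V ** K) \<le> c * norm V
      \<Longrightarrow> \<forall>V. norm (B ** V ** H + V ** K) \<le> c * norm V"
    and pos: "\<And>V. 0 \<le> inner V (A ** V ** H + V ** K)"
  shows "0 \<le> inner V (B ** V ** H + V ** K)"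
proof -
  define L where "L C V = C ** V ** H + V ** K" for C V :: "complex^'n^'n"
  have "linear (L A)"
    unfolding L_def
    by (intro linearI) (simp_all add: matrix_mult.add_left matrix_mult.add_right
        matrix_mult.scaleR_left matrix_mult.scaleR_right scaleR_add_right)
  then obtain M where M: "\<And>V. norm (L A V) \<le> M * norm V"
    using linear_bounded by blast
  have expand: "(norm (C ** V ** H + V ** (K - mat (of_real t))))\<^sup>2
      = (norm (L C V))\<^sup>2 - 2 * t * inner V (L C V) + t\<^sup>2 * (norm V)\<^sup>2"
    for C V :: "complex^'n^'n" and t
  proof -
    have "C ** V ** H + V ** (K - mat (of_real t)) = L C V - t *\<^sub>R V"
      by (simp add: L_def matrix_mult.diff_right mat_mult_commute mat_of_real)
    then show ?thesis
      by (simp only: power2_norm_eq_inner)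
        (simp add: inner_simps inner_commute algebra_simps power2_eq_square)
  qed
  have key: "2 * t * inner V (L B V) + M\<^sup>2 * (norm V)\<^sup>2 \<ge> 0" if "0 < t" for t
  proof -
    have "norm (A ** W ** H + W ** (K - mat (of_real t))) \<le> sqrt (M\<^sup>2 + t\<^sup>2) * norm W" for W
    proof (rule power2_le_imp_le)
      have "0 \<le> t * inner W (L A W)"
        using pos[of W] that by (simp add: L_def)
      moreover have "(norm (L A W))\<^sup>2 \<le> (M * norm W)\<^sup>2"
        by (rule power_mono[OF M]) simp
      ultimately show "(norm (A ** W ** H + W ** (K - mat (of_real t))))\<^sup>2
          \<le> (sqrt (M\<^sup>2 + t\<^sup>2) * norm W)\<^sup>2"
        unfolding expand by (simp add: power_mult_distrib algebra_simps)
    qed simp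
    then have "norm (B ** V ** H + V ** (K - mat (of_real t))) \<le> sqrt (M\<^sup>2 + t\<^sup>2) * norm V"
      using norms[of "sqrt (M\<^sup>2 + t\<^sup>2)" H "K - mat (of_real t)"] by simp
    then have "(norm (B ** V ** H + V ** (K - mat (of_real t))))\<^sup>2
        \<le> (sqrt (M\<^sup>2 + t\<^sup>2) * norm V)\<^sup>2"
      by (rule power_mono) simp
    then have "(norm (L B V))\<^sup>2 - 2 * t * inner V (L B V) \<le> M\<^sup>2 * (norm V)\<^sup>2"
      unfolding expand by (simp add: power_mult_distrib algebra_simps)
    then have "- 2 * t * inner V (L B V) \<le> M\<^sup>2 * (norm V)\<^sup>2"
      using zero_le_power2[of "norm (L B V)"] by linarith
    then show ?thesis
      by simp
  qed
  have "0 \<le> inner V (L B V)"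
  proof (rule ccontr)
    assume "\<not> ?thesis"
    then have neg: "inner V (L B V) < 0"
      by simp
    \<comment> \<open>Chosen so that the expression in \<open>key\<close> equals -1.\<close>
    define t where "t = (M\<^sup>2 * (norm V)\<^sup>2 + 1) / (- 2 * inner V (L B V))"
    have "0 < t"
      unfolding t_def using neg by (intro divide_pos_pos add_nonneg_pos) auto
    moreover have "2 * t * inner V (L B V) = - (M\<^sup>2 * (norm V)\<^sup>2 + 1)"
      unfolding t_def using neg by (simp add: field_simps)
    ultimately show False
      using key[of t] by simp
  qed
  then show ?thesis
    by (simp add: L_def)
qed

text \<open>The orthogonal decomposition used is a real one. Since the kernel is closed under
  complex scaling, the resulting real projection is complex linear and hence given by a
  matrix.\<close>

lemma kernel_projection:
  fixes M :: "complex^'n^'m"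
  obtains P where "projection_matrix P" "\<And>x. P *v x = x \<longleftrightarrow> M *v x = 0"
proof -
  define S where "S = {x. M *v x = 0}"
  have S_add: "x + y \<in> S" if "x \<in> S" "y \<in> S" for x y
    using that by (simp add: S_def matrix_vector_right_distrib)
  have S_smult: "c *s x \<in> S" if "x \<in> S" for x c
    using that by (simp add: S_def matrix_vector_smult)
  have "subspace S"
    unfolding subspace_def using S_add S_smult[of _ "of_real _"]
    by (auto simp: smult_of_real) (simp add: S_def)
  then have "span S = S"
    by simp
  then have "\<exists>y. y \<in> S \<and> (\<forall>w\<in>S. inner (x - y) w = 0)" for x
  proof -
    obtain y z where "y \<in> S" "\<And>w. w \<in> S \<Longrightarrow> orthogonal z w" "x = y + z"
      using orthogonal_subspace_decomp_exists[of S x] unfolding \<open>span S = S\<close> by blast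
    then show ?thesis
      by (intro exI[of _ y]) (simp add: orthogonal_def)
  qed
  then obtain f where fS: "\<And>x. f x \<in> S" and fo: "\<And>x w. w \<in> S \<Longrightarrow> inner (x - f x) w = 0"
    by metis
  \<comment> \<open>The nearest-point characterisation of \<open>f\<close>; both additivity and
    complex homogeneity are deduced from it.\<close>
  have uniq: "f x = y" if "y \<in> S" "\<And>w. w \<in> S \<Longrightarrow> inner (x - y) w = 0" for x y
  proof -
    have "f x - y \<in> S"
      using \<open>subspace S\<close> fS that(1) by (simp add: subspace_diff)
    then have "inner (f x - y) (f x - y) = 0"
      using fo[of "f x - y" x] that(2)[of "f x - y"] by (simp add: inner_diff_left)
    then show ?thesis
      by simp
  qed
  have "Vector_Spaces.linear (*s) (*s) f"
  proof (unfold_locales)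
    fix x y :: "complex^'n" and c :: complex
    show "f (x + y) = f x + f y"
    proof (rule uniq)
      fix w assume "w \<in> S"
      then show "inner (x + y - (f x + f y)) w = 0"
        using fo[of w x] fo[of w y] by (simp add: inner_diff_left inner_add_left)
    qed (simp add: S_add fS)
    show "f (c *s x) = c *s f x"
    proof (rule uniq)
      fix w assume "w \<in> S"
      \<comment> \<open>Moving the factor \<open>c\<close> to the other side turns it into
        \<open>cnj c\<close>, under which \<open>S\<close> is stable.\<close>
      then have "inner (x - f x) (cnj c *s w) = 0"
        by (intro fo S_smult)
      then show "inner (c *s x - c *s f x) w = 0"
        by (simp add: inner_smult_left flip: vector_ssub_ldistrib)
    qed (simp add: S_smult fS)
  qed
  then have P: "matrix f *v x = f x" for x
    by (rule matrix_works)
  have fix_iff: "f x = x \<longleftrightarrow> x \<in> S" for x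
    using fS[of x] by (auto intro!: uniq)
  show ?thesis
  proof (rule that[of "matrix f"])
    show "matrix f *v x = x \<longleftrightarrow> M *v x = 0" for x
      unfolding P fix_iff by (simp add: S_def)
    have "matrix f ** matrix f = matrix f"
      unfolding matrix_eq by (simp add: P fix_iff fS flip: matrix_vector_mul_assoc)
    moreover have "(matrix f)\<^sup>\<dagger> = matrix f"
      unfolding matrix_eq
    proof
      fix x
      have "inner y ((matrix f)\<^sup>\<dagger> *v x) = inner y (f x)" for y
      proof -
        have "inner y ((matrix f)\<^sup>\<dagger> *v x) = inner (f y) x"
          by (simp add: P flip: inner_matrix_vector)
        also have "\<dots> = inner (f y) (f x)"
          using fo[OF fS, of x y] by (simp add: inner_diff_left inner_diff_right inner_commute)
        also have "\<dots> = inner y (f x)"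
          using fo[OF fS, of y x] by (simp add: inner_diff_left)
        finally show ?thesis .
      qed
      then show "(matrix f)\<^sup>\<dagger> *v x = matrix f *v x"
        unfolding P using vector_eq_ldot by blast
    qed
    ultimately show "projection_matrix (matrix f)"
      by (simp add: projection_matrix_def)
  qed
qed

section \<open>Unital completely positive maps\<close>

text \<open>The \<open>V i\<close> are Kraus operators of a unital completely positive map that
  sends \<open>A\<close> to \<open>B\<close>.\<close>

definition ucp_family ::
    "'i set \<Rightarrow> ('i \<Rightarrow> complex^'n^'n) \<Rightarrow> complex^'n^'n \<Rightarrow> complex^'n^'n \<Rightarrow> bool" where
  "ucp_family I V A B \<longleftrightarrow> finite I \<and> (\<Sum>i\<in>I. (V i)\<^sup>\<dagger> ** A ** V i) = B \<and>
     (\<Sum>i\<in>I. (V i)\<^sup>\<dagger> ** V i) = mat 1"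

text \<open>A completely positive map commutes with the adjoint. This lets results about
  \<open>A\<close> be applied to its adjoint with the same Kraus operators.\<close>

lemma ucp_family_adjoint:
  assumes "ucp_family I V A B"
  shows "ucp_family I V A\<^sup>\<dagger> B\<^sup>\<dagger>"
  using assms
  by (auto simp: ucp_family_def conj_transpose_sum conj_transpose_mult matrix_mul_assoc)

lemma ucp_family_compose:
  assumes V: "ucp_family I V A B" and W: "ucp_family J W B C"
  shows "ucp_family (I \<times> J) (\<lambda>(i, j). V i ** W j) A C"
proof -
  have eq: "(\<Sum>(i, j)\<in>I \<times> J. (V i ** W j)\<^sup>\<dagger> ** X ** (V i ** W j))
      = (\<Sum>j\<in>J. (W j)\<^sup>\<dagger> ** (\<Sum>i\<in>I. (V i)\<^sup>\<dagger> ** X ** V i) ** W j)" for X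
    unfolding sum.cartesian_product[symmetric]
    by (subst sum.swap)
      (simp add: matrix_mult.sum_left matrix_mult.sum_right conj_transpose_mult matrix_mul_assoc)
  show ?thesis
    using V W eq[of A] eq[of "mat 1"] by (simp add: ucp_family_def split_def)
qed

section \<open>Kraus families as points of a convex hull\<close>

text \<open>As \<open>f\<close> is homogeneous of degree 2, each convex weight is absorbed as a
  factor \<open>sqrt (u i)\<close> of the matrix.\<close>

lemma hull_to_family:
  fixes f :: "complex^'n^'n \<Rightarrow> 'b::real_vector"
  assumes f: "\<And>s V. f (s *\<^sub>R V) = s\<^sup>2 *\<^sub>R f V" and "x \<in> convex hull (f ` S)"
  obtains I :: "nat set" and W where "finite I" "x = (\<Sum>i\<in>I. f (W i))"
proof -
  obtain k :: nat and u y where u: "\<And>i. i \<in> {1..k} \<Longrightarrow> 0 \<le> u i \<and> y i \<in> f ` S"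
    and x: "x = (\<Sum>i = 1..k. u i *\<^sub>R y i)"
    using assms(2) unfolding convex_hull_indexed by blast
  obtain V where V: "\<And>i. i \<in> {1..k} \<Longrightarrow> y i = f (V i)"
  proof -
    have "\<forall>i\<in>{1..k}. \<exists>V. y i = f V"
      using u by blast
    then show ?thesis
      using that by metis
  qed
  have "x = (\<Sum>i = 1..k. f (sqrt (u i) *\<^sub>R V i))"
    unfolding x
  proof (rule sum.cong)
    fix i assume "i \<in> {1..k}"
    then show "u i *\<^sub>R y i = f (sqrt (u i) *\<^sub>R V i)"
      using u[of i] V[of i] unfolding f by simp
  qed simp
  then show ?thesis
    by (rule that[OF finite_atLeastAtMost])
qed

text \<open>Rescaling each \<open>W i\<close> to norm \<open>r\<close> extracts the weight
  \<open>(norm (W i) / r)\<^sup>2\<close>; the hypothesis on the norms makes these weights sum to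
  1.\<close>

lemma family_to_hull:
  fixes f :: "complex^'n^'n \<Rightarrow> 'b::real_vector"
  assumes f: "\<And>s V. f (s *\<^sub>R V) = s\<^sup>2 *\<^sub>R f V"
    and I: "finite I" "(\<Sum>i\<in>I. (norm (W i))\<^sup>2) = r\<^sup>2" and "0 < r"
  shows "(\<Sum>i\<in>I. f (W i)) \<in> convex hull (f ` sphere 0 r)"
proof -
  have "\<exists>U. norm U = r \<and> V = (norm V / r) *\<^sub>R U" for V :: "complex^'n^'n"
  proof (cases "V = 0")
    case True
    obtain U :: "complex^'n^'n" where "norm U = r"
      using vector_choose_size[of r] \<open>0 < r\<close> by auto
    with True show ?thesis
      by auto
  next
    case False
    then show ?thesis
      using \<open>0 < r\<close> by (intro exI[of _ "(r / norm V) *\<^sub>R V"]) simp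
  qed
  then obtain U :: "complex^'n^'n \<Rightarrow> complex^'n^'n"
    where U: "\<And>V. norm (U V) = r" "\<And>V. V = (norm V / r) *\<^sub>R U V"
    by metis
  have "(\<Sum>i\<in>I. (norm (W i) / r)\<^sup>2 *\<^sub>R f (U (W i))) \<in> convex hull (f ` sphere 0 r)"
  proof (rule convex_sum)
    show "(\<Sum>i\<in>I. (norm (W i) / r)\<^sup>2) = 1"
      using I(2) \<open>0 < r\<close> by (simp add: power_divide flip: sum_divide_distrib)
    show "f (U (W i)) \<in> convex hull (f ` sphere 0 r)" for i
      by (intro hull_inc imageI) (simp add: U)
  qed (use I in auto)
  moreover have "(norm V / r)\<^sup>2 *\<^sub>R f (U V) = f V" for V
    using f[of "norm V / r" "U V"] U(2)[of V] by simp
  ultimately show ?thesis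
    by simp
qed

lemma norm_mat_1_pos: "0 < norm (mat 1 :: complex^'n^'n)"
  by (simp add: mat_1_neq_0)

text \<open>Take the trace of the unitality condition. This is why the hulls are built over the
  sphere of radius \<open>norm (mat 1)\<close>.\<close>

lemma ucp_family_norm:
  fixes V :: "'i \<Rightarrow> complex^'n^'n"
  assumes "ucp_family I V A B"
  shows "(\<Sum>i\<in>I. (norm (V i))\<^sup>2) = (norm (mat 1 :: complex^'n^'n))\<^sup>2"
proof -
  have "(norm X)\<^sup>2 = inner (mat 1) (X\<^sup>\<dagger> ** X)" for X :: "complex^'n^'n"
    by (simp add: power2_norm_eq_inner flip: inner_matrix_mult_left)
  then have "(\<Sum>i\<in>I. (norm (V i))\<^sup>2) = inner (mat 1) (\<Sum>i\<in>I. (V i)\<^sup>\<dagger> ** V i)"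
    by (simp add: inner_sum_right)
  also have "\<dots> = (norm (mat 1 :: complex^'n^'n))\<^sup>2"
    using assms by (simp add: ucp_family_def power2_norm_eq_inner)
  finally show ?thesis .
qed

lemmas continuous_matrix_mult [continuous_intros] = matrix_mult.continuous_on
lemmas continuous_conj_transpose [continuous_intros] =
  bounded_linear.continuous_on[OF bounded_linear_conj_transpose]

text \<open>A hyperplane separating \<open>(B, mat 1)\<close> from the compact hull of the points
  (V*AV, V*V) would give a pencil that is positive for \<open>A\<close> but negative for
  \<open>B\<close> at the identity, against \<open>positivity_transfer\<close>.\<close>

lemma ucp_family_exists:
  fixes A B :: "complex^'n^'n"
  assumes norms: "\<And>(H :: complex^'n^'n) K c. 0 \<le> c
      \<Longrightarrow> \<forall>V. norm (A ** V ** H + V ** K) \<le> c * norm V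
      \<Longrightarrow> \<forall>V. norm (B ** V ** H + V ** K) \<le> c * norm V"
  obtains I :: "nat set" and V where "ucp_family I V A B"
proof -
  define r where "r = norm (mat 1 :: complex^'n^'n)"
  have "0 < r"
    unfolding r_def by (rule norm_mat_1_pos)
  define f where "f V = (V\<^sup>\<dagger> ** A ** V, V\<^sup>\<dagger> ** V)" for V :: "complex^'n^'n"
  have f_scale: "f (s *\<^sub>R V) = s\<^sup>2 *\<^sub>R f V" for s V
    by (simp add: f_def conj_transpose_scaleR matrix_mult.scaleR_left matrix_mult.scaleR_right
        power2_eq_square)
  have "compact (f ` sphere 0 r)"
    unfolding f_def by (intro compact_continuous_image continuous_intros compact_sphere)
  then have compact: "compact (convex hull (f ` sphere 0 r))"
    by (rule compact_convex_hull)
  have "(B, mat 1) \<in> convex hull (f ` sphere 0 r)"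
  proof (rule ccontr)
    assume "(B, mat 1) \<notin> convex hull (f ` sphere 0 r)"
    then obtain a b where a: "inner a (B, mat 1) < b"
      and sep: "\<And>x. x \<in> convex hull (f ` sphere 0 r) \<Longrightarrow> b < inner a x"
      using separating_hyperplane_closed_point[OF convex_convex_hull compact_imp_closed[OF compact]]
      by blast
    obtain H K where HK: "a = (H, K)"
      by (cases a)
    \<comment> \<open>Subtracting \<open>b / r\<^sup>2\<close> moves the separating level to 0 on
      the sphere of radius \<open>r\<close> and makes the condition homogeneous in
      \<open>V\<close>.\<close>
    define L where "L C V = C ** V ** H\<^sup>\<dagger> + V ** (K\<^sup>\<dagger> - mat (of_real (b / r\<^sup>2)))"
      for C V :: "complex^'n^'n"
    have L: "inner V (L C V)
        = inner H (V\<^sup>\<dagger> ** C ** V) + inner K (V\<^sup>\<dagger> ** V) - b / r\<^sup>2 * (norm V)\<^sup>2" for C V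
    proof -
      have "inner V (C ** V ** H\<^sup>\<dagger>) = inner H (V\<^sup>\<dagger> ** C ** V)"
        by (metis inner_matrix_mult_left inner_matrix_mult_right matrix_mul_assoc)
      moreover have "inner V (V ** K\<^sup>\<dagger>) = inner K (V\<^sup>\<dagger> ** V)"
        by (metis inner_matrix_mult_left inner_matrix_mult_right)
      ultimately show ?thesis
        by (simp add: L_def matrix_mult.diff_right mat_mult_commute mat_of_real inner_simps
            power2_norm_eq_inner del: of_real_divide of_real_power)
    qed
    have sphere: "0 \<le> inner V (L A V)" if "norm V = r" for V
    proof -
      have "b < inner a (f V)"
        by (intro sep hull_inc imageI) (simp add: that)
      then show ?thesis
        using that \<open>0 < r\<close> by (simp add: L HK f_def)
    qed
    have pos: "0 \<le> inner V (L A V)" for V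
    proof (cases "V = 0")
      case False
      define s where "s = r / norm V"
      have "0 < s"
        using False \<open>0 < r\<close> by (simp add: s_def)
      have "0 \<le> inner (s *\<^sub>R V) (L A (s *\<^sub>R V))"
        using False \<open>0 < r\<close> by (intro sphere) (simp add: s_def)
      also have "\<dots> = s\<^sup>2 * inner V (L A V)"
        by (simp add: L_def matrix_mult.scaleR_left matrix_mult.scaleR_right power2_eq_square
            inner_simps algebra_simps)
      finally show ?thesis
        using \<open>0 < s\<close> by (simp add: zero_le_mult_iff)
    qed simp
    \<comment> \<open>At the identity the form equals \<open>inner a (B, mat 1) - b\<close>, which
      is negative by the separation.\<close>
    have "0 \<le> inner (mat 1) (L B (mat 1))"
      unfolding L_def
      by (rule positivity_transfer[of A B]) (use norms pos in \<open>auto simp: L_def\<close>)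
    then show False
      using a \<open>0 < r\<close> by (simp add: L HK flip: r_def)
  qed
  then obtain I :: "nat set" and W where "finite I" "(B, mat 1) = (\<Sum>i\<in>I. f (W i))"
    using hull_to_family[of f, OF f_scale] by metis
  then have "ucp_family I W A B"
    by (simp add: ucp_family_def f_def prod_eq_iff fst_sum snd_sum)
  then show ?thesis
    using that by blast
qed

section \<open>Invariants of the dual map\<close>

text \<open>The images of the identity under the dual maps X to sum V X V*, taken over all unital
  completely positive maps fixing \<open>A\<close>.\<close>

definition dual_unit_set :: "complex^'n^'n \<Rightarrow> (complex^'n^'n) set" where
  "dual_unit_set A = {R. \<exists>(I :: nat set) V. ucp_family I V A A \<and> R = (\<Sum>i\<in>I. V i ** (V i)\<^sup>\<dagger>)}"

text \<open>The first two components record the constraints on a family and the third the resulting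
  element, so \<open>dual_unit_set\<close> becomes a slice of a compact convex hull.\<close>

definition kraus_point :: "complex^'n^'n \<Rightarrow> complex^'n^'n
    \<Rightarrow> (complex^'n^'n) \<times> (complex^'n^'n) \<times> (complex^'n^'n)" where
  "kraus_point A V = (V\<^sup>\<dagger> ** A ** V, V\<^sup>\<dagger> ** V, V ** V\<^sup>\<dagger>)"

abbreviation kraus_hull :: "complex^'n^'n
    \<Rightarrow> ((complex^'n^'n) \<times> (complex^'n^'n) \<times> (complex^'n^'n)) set" where
  "kraus_hull A \<equiv> convex hull (kraus_point A ` sphere 0 (norm (mat 1 :: complex^'n^'n)))"

lemma kraus_point_scale: "kraus_point A (s *\<^sub>R V) = s\<^sup>2 *\<^sub>R kraus_point A V"
  by (simp add: kraus_point_def conj_transpose_scaleR matrix_mult.scaleR_left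
      matrix_mult.scaleR_right power2_eq_square)

lemma family_in_kraus_hull:
  assumes "ucp_family I V A A"
  shows "(A, mat 1, \<Sum>i\<in>I. V i ** (V i)\<^sup>\<dagger>) \<in> kraus_hull A"
proof -
  have "(A, mat 1, \<Sum>i\<in>I. V i ** (V i)\<^sup>\<dagger>) = (\<Sum>i\<in>I. kraus_point A (V i))"
    using assms by (simp add: ucp_family_def kraus_point_def prod_eq_iff fst_sum snd_sum)
  also have "\<dots> \<in> kraus_hull A"
    using assms by (intro family_to_hull kraus_point_scale ucp_family_norm[OF assms] norm_mat_1_pos)
      (simp add: ucp_family_def)
  finally show ?thesis .
qed

lemma dual_unit_set_eq: "dual_unit_set A = {R. (A, mat 1, R) \<in> kraus_hull A}"
proof (intro equalityI subsetI)
  fix R assume "R \<in> {R. (A, mat 1, R) \<in> kraus_hull A}"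
  then obtain I :: "nat set" and W where "finite I" "(A, mat 1, R) = (\<Sum>i\<in>I. kraus_point A (W i))"
    using hull_to_family[of "kraus_point A", OF kraus_point_scale] by (metis mem_Collect_eq)
  then have "ucp_family I W A A" "R = (\<Sum>i\<in>I. W i ** (W i)\<^sup>\<dagger>)"
    by (simp_all add: ucp_family_def kraus_point_def prod_eq_iff fst_sum snd_sum)
  then show "R \<in> dual_unit_set A"
    unfolding dual_unit_set_def by blast
qed (auto simp: dual_unit_set_def intro: family_in_kraus_hull)

text \<open>Passing through the convex hull replaces an arbitrary index type by the naturals, as is
  needed for families indexed by pairs.\<close>

lemma dual_unit_setI:
  assumes "ucp_family I V A A"
  shows "(\<Sum>i\<in>I. V i ** (V i)\<^sup>\<dagger>) \<in> dual_unit_set A"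
  using family_in_kraus_hull[OF assms] by (simp add: dual_unit_set_eq)

lemma convex_dual_unit_set: "convex (dual_unit_set A)"
  unfolding dual_unit_set_eq
proof (rule convexI, unfold mem_Collect_eq)
  fix R S u v
  assume R: "(A, mat 1, R) \<in> kraus_hull A" and S: "(A, mat 1, S) \<in> kraus_hull A"
    and u: "0 \<le> u" "0 \<le> v" "u + v = (1 :: real)"
  have "u *\<^sub>R (A, mat 1, R) + v *\<^sub>R (A, mat 1, S) \<in> kraus_hull A"
    by (rule convexD[OF convex_convex_hull R S u])
  then show "(A, mat 1, u *\<^sub>R R + v *\<^sub>R S) \<in> kraus_hull A"
    using u(3) by (simp flip: scaleR_add_left)
qed

lemma compact_dual_unit_set: "compact (dual_unit_set A)"
proof -
  have "compact (kraus_hull A)"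
    unfolding kraus_point_def
    by (intro compact_convex_hull compact_continuous_image continuous_intros compact_sphere)
  then have "compact (kraus_hull A \<inter> {A} \<times> {mat 1} \<times> UNIV)"
    by (intro compact_Int_closed closed_Times) auto
  then have "compact ((\<lambda>x. snd (snd x)) ` (kraus_hull A \<inter> {A} \<times> {mat 1} \<times> UNIV))"
    by (rule compact_continuous_image[rotated]) (intro continuous_intros)
  also have "(\<lambda>x. snd (snd x)) ` (kraus_hull A \<inter> {A} \<times> {mat 1} \<times> UNIV) = dual_unit_set A"
    unfolding dual_unit_set_eq by force
  finally show ?thesis .
qed

text \<open>Composing \<open>E\<close> with a family for \<open>R\<close> yields a family for the
  dual image of \<open>R\<close>, so the dual map sends the compact convex
  \<open>dual_unit_set A\<close> to itself and Brouwer's theorem applies.\<close>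

lemma dual_fixed_point:
  assumes E: "ucp_family I E A A"
  obtains R where "R \<in> dual_unit_set A" "(\<Sum>i\<in>I. E i ** R ** (E i)\<^sup>\<dagger>) = R"
proof (rule brouwer[OF compact_dual_unit_set convex_dual_unit_set])
  show "dual_unit_set A \<noteq> {}"
    using dual_unit_setI[OF E] by blast
  show "continuous_on (dual_unit_set A) (\<lambda>R. \<Sum>i\<in>I. E i ** R ** (E i)\<^sup>\<dagger>)"
    by (intro continuous_intros)
  show "(\<lambda>R. \<Sum>i\<in>I. E i ** R ** (E i)\<^sup>\<dagger>) \<in> dual_unit_set A \<rightarrow> dual_unit_set A"
  proof
    fix R assume "R \<in> dual_unit_set A"
    then obtain J :: "nat set" and F where F: "ucp_family J F A A"
      and R: "R = (\<Sum>j\<in>J. F j ** (F j)\<^sup>\<dagger>)"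
      unfolding dual_unit_set_def by blast
    have "(\<Sum>(i, j)\<in>I \<times> J. (E i ** F j) ** (E i ** F j)\<^sup>\<dagger>) \<in> dual_unit_set A"
      using dual_unit_setI[OF ucp_family_compose[OF E F]] by (simp add: split_def)
    also have "(\<Sum>(i, j)\<in>I \<times> J. (E i ** F j) ** (E i ** F j)\<^sup>\<dagger>) = (\<Sum>i\<in>I. E i ** R ** (E i)\<^sup>\<dagger>)"
      unfolding R sum.cartesian_product[symmetric]
      by (simp add: matrix_mult.sum_left matrix_mult.sum_right conj_transpose_mult matrix_mul_assoc)
    finally show "(\<Sum>i\<in>I. E i ** R ** (E i)\<^sup>\<dagger>) \<in> dual_unit_set A" .
  qed
qed (use that in blast)

section \<open>Rigidity of unital completely positive maps fixing an irreducible matrix\<close>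

lemma sum_norm_left_family:
  fixes V :: "'i \<Rightarrow> complex^'n^'n"
  assumes "ucp_family I V A B"
  shows "(\<Sum>i\<in>I. (norm (V i ** X))\<^sup>2) = (norm X)\<^sup>2"
proof -
  have "(\<Sum>i\<in>I. (norm (V i ** X))\<^sup>2) = (\<Sum>i\<in>I. inner X (((V i)\<^sup>\<dagger> ** V i) ** X))"
    by (simp add: power2_norm_eq_inner inner_matrix_mult_left matrix_mul_assoc)
  also have "\<dots> = inner X ((\<Sum>i\<in>I. (V i)\<^sup>\<dagger> ** V i) ** X)"
    by (simp add: inner_sum_right matrix_mult.sum_left)
  finally show ?thesis
    using assms by (simp add: ucp_family_def power2_norm_eq_inner)
qed

lemma sum_norm_right_family:
  fixes F :: "'j \<Rightarrow> complex^'n^'n"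
  shows "(\<Sum>j\<in>J. (norm (X ** F j))\<^sup>2) = inner X (X ** (\<Sum>j\<in>J. F j ** (F j)\<^sup>\<dagger>))"
proof -
  have "(norm (X ** F j))\<^sup>2 = inner X (X ** (F j ** (F j)\<^sup>\<dagger>))" for j
    unfolding power2_norm_eq_inner inner_matrix_mult_right by (simp add: matrix_mul_assoc)
  then show ?thesis
    by (simp add: inner_sum_right matrix_mult.sum_right)
qed

text \<open>Equality case of the Kadison--Schwarz inequality \<open>A\<^sup>\<dagger> A \<le> \<Sum> E\<^sub>i\<^sup>\<dagger> A\<^sup>\<dagger> Q A E\<^sub>i\<close>,
  integrated against the invariant \<open>R\<close>.\<close>

lemma family_intertwines:
  fixes A Q R :: "complex^'n^'n" and F :: "'j \<Rightarrow> complex^'n^'n"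
  assumes E: "ucp_family I E A A" and J: "finite J"
    and R: "R = (\<Sum>j\<in>J. F j ** (F j)\<^sup>\<dagger>)"
    and fixed: "(\<Sum>i\<in>I. E i ** R ** (E i)\<^sup>\<dagger>) = R"
    and Q: "Q\<^sup>\<dagger> = Q" "Q ** Q = Q" "\<And>i. i \<in> I \<Longrightarrow> Q ** E i = E i"
  shows "i \<in> I \<Longrightarrow> j \<in> J \<Longrightarrow> Q ** A ** E i ** F j = E i ** A ** F j"
    and "j \<in> J \<Longrightarrow> Q ** A ** F j = A ** F j"
proof -
  define D where "D i j = Q ** A ** E i ** F j - E i ** A ** F j" for i j
  have I: "finite I"
    using E by (simp add: ucp_family_def)
  have EQ: "(E i)\<^sup>\<dagger> ** Q = (E i)\<^sup>\<dagger>" if "i \<in> I" for i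
    using Q(3)[OF that] Q(1) by (metis conj_transpose_mult)
  \<comment> \<open>Invariance of \<open>R\<close> under the dual map removes the factors
    \<open>E i\<close>.\<close>
  have first: "(\<Sum>i\<in>I. \<Sum>j\<in>J. (norm (Q ** A ** E i ** F j))\<^sup>2) = (\<Sum>j\<in>J. (norm (Q ** A ** F j))\<^sup>2)"
  proof -
    have "(\<Sum>i\<in>I. \<Sum>j\<in>J. (norm (Q ** A ** E i ** F j))\<^sup>2)
        = (\<Sum>i\<in>I. inner (Q ** A ** E i) (Q ** A ** E i ** R))"
      unfolding R by (intro sum.cong refl sum_norm_right_family)
    also have "\<dots> = (\<Sum>i\<in>I. inner (Q ** A) (Q ** A ** (E i ** R ** (E i)\<^sup>\<dagger>)))"
      unfolding inner_matrix_mult_right[of _ "E _"] by (simp add: matrix_mul_assoc)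
    also have "\<dots> = inner (Q ** A) (Q ** A ** R)"
      unfolding inner_sum_right[symmetric] matrix_mult.sum_right[symmetric] fixed by (rule refl)
    also have "\<dots> = (\<Sum>j\<in>J. (norm (Q ** A ** F j))\<^sup>2)"
      unfolding R by (rule sum_norm_right_family[symmetric])
    finally show ?thesis .
  qed
  \<comment> \<open>\<open>Q\<close> is absorbed by the adjoint of \<open>E i\<close>; summing over
    \<open>i\<close> then gives back \<open>A\<close>, since the family fixes it.\<close>
  have cross: "(\<Sum>i\<in>I. inner (Q ** A ** E i ** F j) (E i ** A ** F j)) = (norm (A ** F j))\<^sup>2" for j
  proof -
    have "(\<Sum>i\<in>I. inner (Q ** A ** E i ** F j) (E i ** A ** F j))
        = (\<Sum>i\<in>I. inner (((E i)\<^sup>\<dagger> ** A ** E i) ** F j) (A ** F j))"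
    proof (rule sum.cong)
      fix i assume "i \<in> I"
      have "inner (Q ** A ** E i ** F j) (E i ** A ** F j)
          = inner (E i ** (A ** F j)) (Q ** A ** E i ** F j)"
        by (simp add: inner_commute matrix_mul_assoc)
      also have "\<dots> = inner (A ** F j) (((E i)\<^sup>\<dagger> ** Q) ** A ** E i ** F j)"
        unfolding inner_matrix_mult_left[of "E i"] by (simp add: matrix_mul_assoc)
      finally show "inner (Q ** A ** E i ** F j) (E i ** A ** F j)
          = inner (((E i)\<^sup>\<dagger> ** A ** E i) ** F j) (A ** F j)"
        unfolding EQ[OF \<open>i \<in> I\<close>] by (simp only: inner_commute)
    qed simp
    also have "\<dots> = inner ((\<Sum>i\<in>I. (E i)\<^sup>\<dagger> ** A ** E i) ** F j) (A ** F j)"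
      by (simp add: inner_sum_left matrix_mult.sum_left)
    finally show ?thesis
      using E by (simp add: ucp_family_def power2_norm_eq_inner)
  qed
  have last: "(\<Sum>i\<in>I. (norm (E i ** A ** F j))\<^sup>2) = (norm (A ** F j))\<^sup>2" for j
    using sum_norm_left_family[OF E, of "A ** F j"] by (simp add: matrix_mul_assoc)
  have expand: "(norm (D i j))\<^sup>2 = (norm (Q ** A ** E i ** F j))\<^sup>2
      - 2 * inner (Q ** A ** E i ** F j) (E i ** A ** F j) + (norm (E i ** A ** F j))\<^sup>2" for i j
    unfolding D_def power2_norm_eq_inner by (simp add: inner_simps inner_commute)
  have pythagoras: "(norm (A ** F j - Q ** A ** F j))\<^sup>2
      = (norm (A ** F j))\<^sup>2 - (norm (Q ** A ** F j))\<^sup>2" for j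
  proof -
    have "inner (Q ** (A ** F j)) (Q ** (A ** F j)) = inner (A ** F j) (Q ** (A ** F j))"
      unfolding inner_matrix_mult_left[of Q] by (simp add: matrix_mul_assoc Q)
    then show ?thesis
      unfolding power2_norm_eq_inner by (simp add: inner_simps inner_commute matrix_mul_assoc)
  qed
  \<comment> \<open>The total squared defect equals minus a sum of squares, so both sums
    vanish.\<close>
  have "(\<Sum>i\<in>I. \<Sum>j\<in>J. (norm (D i j))\<^sup>2)
      = (\<Sum>i\<in>I. \<Sum>j\<in>J. (norm (Q ** A ** E i ** F j))\<^sup>2)
        - 2 * (\<Sum>j\<in>J. \<Sum>i\<in>I. inner (Q ** A ** E i ** F j) (E i ** A ** F j))
        + (\<Sum>j\<in>J. \<Sum>i\<in>I. (norm (E i ** A ** F j))\<^sup>2)"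
    unfolding expand sum.swap[of _ J I]
    by (simp add: sum.distrib sum_subtractf sum_distrib_left)
  also have "\<dots> = - (\<Sum>j\<in>J. (norm (A ** F j - Q ** A ** F j))\<^sup>2)"
    unfolding first cross last pythagoras by (simp add: sum_subtractf)
  finally have sum_zero: "(\<Sum>i\<in>I. \<Sum>j\<in>J. (norm (D i j))\<^sup>2)
      + (\<Sum>j\<in>J. (norm (A ** F j - Q ** A ** F j))\<^sup>2) = 0"
    by simp
  then have "(\<Sum>i\<in>I. \<Sum>j\<in>J. (norm (D i j))\<^sup>2) = 0"
    and zero: "(\<Sum>j\<in>J. (norm (A ** F j - Q ** A ** F j))\<^sup>2) = 0"
    by (simp_all add: add_nonneg_eq_0_iff sum_nonneg)
  then have D: "D i j = 0" if "i \<in> I" "j \<in> J" for i j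
    using that I J by (simp add: sum_nonneg_eq_0_iff sum_nonneg)
  then show "Q ** A ** E i ** F j = E i ** A ** F j" if "i \<in> I" "j \<in> J"
    using that by (simp add: D_def)
  show "Q ** A ** F j = A ** F j" if "j \<in> J"
    using zero that J by (simp add: sum_nonneg_eq_0_iff)
qed

text \<open>Pairing the sum with \<open>x\<close> gives a vanishing sum of squared norms.\<close>

lemma kernel_sum_gram:
  fixes F :: "'j \<Rightarrow> complex^'n^'n"
  assumes "finite J" "(\<Sum>j\<in>J. F j ** (F j)\<^sup>\<dagger>) *v x = 0" "j \<in> J"
  shows "(F j)\<^sup>\<dagger> *v x = 0"
proof -
  have "(\<Sum>j\<in>J. X j) *v x = (\<Sum>j\<in>J. X j *v x)" for X :: "'j \<Rightarrow> complex^'n^'n"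
    by (induction J rule: infinite_finite_induct) (simp_all add: matrix_vector_mult_add_rdistrib)
  then have "0 = inner x (\<Sum>j\<in>J. (F j ** (F j)\<^sup>\<dagger>) *v x)"
    using assms(2) by simp
  also have "\<dots> = (\<Sum>j\<in>J. (norm ((F j)\<^sup>\<dagger> *v x))\<^sup>2)"
    by (simp add: inner_sum_right power2_norm_eq_inner inner_matrix_vector matrix_vector_mul_assoc)
  finally show ?thesis
    using assms(1,3) by (simp add: sum_nonneg_eq_0_iff)
qed

text \<open>Invariance of the range of \<open>P\<close> under \<open>A\<close> and its adjoint makes
  \<open>P\<close> commute with \<open>A\<close>: take the adjoint of the second condition.\<close>

lemma irreducible_invariant_projection:
  assumes "irreducible_matrix A" "projection_matrix P"
    and A: "P ** A ** P = A ** P" and A': "P ** A\<^sup>\<dagger> ** P = A\<^sup>\<dagger> ** P"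
  shows "P = 0 \<or> P = mat 1"
proof -
  have "P\<^sup>\<dagger> = P"
    using assms(2) by (simp add: projection_matrix_def)
  then have "P ** A ** P = P ** A"
    using arg_cong[OF A', of conj_transpose] by (simp add: conj_transpose_mult matrix_mul_assoc)
  then show ?thesis
    using assms by (simp add: irreducible_matrix_def)
qed

lemma subspace_kernel: "subspace {x. M *v x = 0}" for M :: "complex^'n^'m"
  by (auto simp: subspace_def matrix_vector_right_distrib linear_scale)

text \<open>Choose \<open>R\<close> with kernel of maximal dimension and an invariant
  \<open>T\<close> of the dual map of a family for \<open>R\<close>. The two kernels agree, and the
  projection onto them reduces \<open>A\<close>, so irreducibility makes them zero; by maximality
  the kernel of \<open>S\<close> is zero too.\<close>

lemma irreducible_dual_unit_injective:
  fixes A :: "complex^'n^'n"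
  assumes A: "irreducible_matrix A" and "S \<in> dual_unit_set A" "S *v x = 0"
  shows "x = 0"
proof -
  define d where "d M = dim {x. M *v x = 0}" for M :: "complex^'n^'n"
  have "\<exists>R. R \<in> dual_unit_set A \<and> (\<forall>T. T \<in> dual_unit_set A \<longrightarrow> d T \<le> d R)"
  proof (rule ex_has_greatest_nat[of "\<lambda>R. R \<in> dual_unit_set A" S d "DIM(complex^'n) + 1"])
    show "S \<in> dual_unit_set A"
      by fact
    show "\<forall>T. T \<in> dual_unit_set A \<longrightarrow> d T < DIM(complex^'n) + 1"
      using dim_subset_UNIV less_Suc_eq_le unfolding d_def by (metis Suc_eq_plus1)
  qed
  then obtain R where R: "R \<in> dual_unit_set A" and max: "\<And>T. T \<in> dual_unit_set A \<Longrightarrow> d T \<le> d R"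
    by blast
  obtain I :: "nat set" and E where E: "ucp_family I E A A" and RE: "R = (\<Sum>i\<in>I. E i ** (E i)\<^sup>\<dagger>)"
    using R unfolding dual_unit_set_def by blast
  obtain T where T: "T \<in> dual_unit_set A" and fixed: "(\<Sum>i\<in>I. E i ** T ** (E i)\<^sup>\<dagger>) = T"
    by (rule dual_fixed_point[OF E])
  obtain J :: "nat set" and F where F: "ucp_family J F A A" and TF: "T = (\<Sum>j\<in>J. F j ** (F j)\<^sup>\<dagger>)"
    using T unfolding dual_unit_set_def by blast
  have IJ: "finite I" "finite J"
    using E F by (simp_all add: ucp_family_def)
  have sum_vec: "(\<Sum>i\<in>I. X i) *v x = (\<Sum>i\<in>I. X i *v x)" for X :: "nat \<Rightarrow> complex^'n^'n" and x
    by (induction I rule: infinite_finite_induct) (simp_all add: matrix_vector_mult_add_rdistrib)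
  have "{x. R *v x = 0} \<subseteq> {x. T *v x = 0}"
  proof
    fix x assume "x \<in> {x. R *v x = 0}"
    then have "(E i)\<^sup>\<dagger> *v x = 0" if "i \<in> I" for i
      using kernel_sum_gram[OF IJ(1) _ that] by (simp add: RE)
    then have "(\<Sum>i\<in>I. E i ** T ** (E i)\<^sup>\<dagger>) *v x = 0"
      by (simp add: sum_vec flip: matrix_vector_mul_assoc)
    then show "x \<in> {x. T *v x = 0}"
      by (simp add: fixed)
  qed
  \<comment> \<open>Maximality of the kernel of \<open>R\<close> upgrades the inclusion to
    equality.\<close>
  then have kernels: "{x. R *v x = 0} = {x. T *v x = 0}"
    using max[OF T] unfolding d_def by (intro subspace_dim_equal subspace_kernel)
  obtain P where P: "projection_matrix P" and P_iff: "\<And>x. P *v x = x \<longleftrightarrow> T *v x = 0"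
    using kernel_projection[of T] by blast
  have PP: "P ** P = P" "P\<^sup>\<dagger> = P"
    using P by (simp_all add: projection_matrix_def)
  have TP: "T *v (P *v x) = 0" for x
    unfolding P_iff[symmetric] by (simp add: matrix_vector_mul_assoc PP)
  have EP: "(E i)\<^sup>\<dagger> ** P = 0" if "i \<in> I" for i
    unfolding matrix_eq
    using kernel_sum_gram[OF IJ(1) _ that] TP kernels
    by (auto simp: RE simp flip: matrix_vector_mul_assoc)
  have FP: "(F j)\<^sup>\<dagger> ** P = 0" if "j \<in> J" for j
    unfolding matrix_eq
    using kernel_sum_gram[OF IJ(2) _ that] TP
    by (auto simp: TF simp flip: matrix_vector_mul_assoc)
  define Q where "Q = mat 1 - P"
  have Q: "Q\<^sup>\<dagger> = Q" "Q ** Q = Q"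
    by (simp_all add: Q_def conj_transpose_diff matrix_mult.diff_left matrix_mult.diff_right PP)
  have PE: "P ** E i = 0" if "i \<in> I" for i
    using arg_cong[OF EP[OF that], of conj_transpose]
    by (simp add: conj_transpose_mult PP conj_transpose_zero)
  have QE: "Q ** E i = E i" if "i \<in> I" for i
    by (simp add: Q_def matrix_mult.diff_left PE[OF that])
  have invariant: "P ** C\<^sup>\<dagger> ** P = C\<^sup>\<dagger> ** P" if C: "ucp_family I E C C" for C
  proof -
    have "(F j)\<^sup>\<dagger> ** C\<^sup>\<dagger> ** P = 0" if "j \<in> J" for j
    proof -
      \<comment> \<open>This says that \<open>C\<close> maps the range of \<open>F j\<close> into
        the complement of the kernel of \<open>T\<close>; dually, the adjoint of \<open>C\<close>
        preserves that kernel.\<close>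
      have "P ** C ** F j = 0"
        using family_intertwines(2)[OF C IJ(2) TF fixed Q QE that]
        by (simp add: Q_def matrix_mult.diff_left)
      then show ?thesis
        using arg_cong[of _ 0 conj_transpose]
        by (metis conj_transpose_mult conj_transpose_zero PP(2) matrix_mul_assoc)
    qed
    then have "T ** (C\<^sup>\<dagger> ** P) = 0"
      unfolding TF matrix_mult.sum_left
      by (intro sum.neutral ballI) (metis matrix_mul_assoc matrix_mult.zero_right)
    then have "P *v ((C\<^sup>\<dagger> ** P) *v x) = (C\<^sup>\<dagger> ** P) *v x" for x
      unfolding P_iff by (simp add: matrix_vector_mul_assoc)
    then show ?thesis
      unfolding matrix_eq by (simp add: matrix_vector_mul_assoc matrix_mul_assoc)
  qed
  have "P = 0 \<or> P = mat 1"
    using invariant[OF ucp_family_adjoint[OF E]] invariant[OF E]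
    by (intro irreducible_invariant_projection[OF A P]) simp_all
  \<comment> \<open>Otherwise every \<open>F j\<close> would vanish, contradicting
    unitality.\<close>
  moreover have "P \<noteq> mat 1"
  proof
    assume "P = mat 1"
    then have "(F j)\<^sup>\<dagger> = 0" if "j \<in> J" for j
      using FP[OF that] by simp
    then have "(\<Sum>j\<in>J. (F j)\<^sup>\<dagger> ** F j) = 0"
      by (simp add: matrix_mult.zero_left)
    then show False
      using F mat_1_neq_0[where 'n = 'n] unfolding ucp_family_def by metis
  qed
  ultimately have "P = 0"
    by blast
  then have "{x. R *v x = 0} = {0}"
    unfolding kernels P_iff[symmetric] by auto
  then have "d R = 0"
    by (simp add: d_def)
  then have "d S = 0"
    using max[OF assms(2)] by simp
  then have "{x. S *v x = 0} \<subseteq> {0}"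
    unfolding d_def dim_eq_0 .
  then show ?thesis
    using assms(3) by blast
qed

text \<open>The intertwining relation with \<open>Q = mat 1\<close> says that the commutator of
  \<open>A\<close> and \<open>E i\<close> kills every \<open>F j\<close>, hence kills
  \<open>T\<close>, which is invertible by \<open>irreducible_dual_unit_injective\<close>.\<close>

lemma irreducible_family_commutes:
  fixes A :: "complex^'n^'n"
  assumes A: "irreducible_matrix A" and E: "ucp_family I E A A" and "i \<in> I"
  shows "A ** E i = E i ** A" "A\<^sup>\<dagger> ** E i = E i ** A\<^sup>\<dagger>"
proof -
  obtain T where T: "T \<in> dual_unit_set A" and fixed: "(\<Sum>i\<in>I. E i ** T ** (E i)\<^sup>\<dagger>) = T"
    by (rule dual_fixed_point[OF E])
  obtain J :: "nat set" and F where F: "ucp_family J F A A" and TF: "T = (\<Sum>j\<in>J. F j ** (F j)\<^sup>\<dagger>)"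
    using T unfolding dual_unit_set_def by blast
  have J: "finite J"
    using F by (simp add: ucp_family_def)
  have "\<exists>Z. Z ** T = mat 1"
    unfolding matrix_left_invertible_ker using irreducible_dual_unit_injective[OF A T] by blast
  then obtain Z where Z: "T ** Z = mat 1"
    using matrix_left_right_inverse by blast
  have commutes: "C ** E i = E i ** C" if C: "ucp_family I E C C" for C
  proof -
    have "C ** E i ** F j = E i ** C ** F j" if "j \<in> J" for j
      using family_intertwines(1)[OF C J TF fixed, of "mat 1" i j] \<open>i \<in> I\<close> that by simp
    then have "C ** E i ** T = E i ** C ** T"
      unfolding TF matrix_mult.sum_right by (simp add: matrix_mul_assoc)
    then have "C ** E i ** (T ** Z) = E i ** C ** (T ** Z)"
      by (simp add: matrix_mul_assoc)
    then show ?thesis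
      by (simp add: Z)
  qed
  show "A ** E i = E i ** A" "A\<^sup>\<dagger> ** E i = E i ** A\<^sup>\<dagger>"
    using commutes[OF E] commutes[OF ucp_family_adjoint[OF E]] by auto
qed

section \<open>Scalar commutant of an irreducible matrix\<close>

text \<open>The eigenspace of the Gram matrix for its top eigenvalue is nonzero and reduces
  \<open>A\<close>, so it is the whole space.\<close>

lemma irreducible_gram_scalar:
  fixes A X :: "complex^'n^'n"
  assumes A: "irreducible_matrix A"
    and X: "A ** (X\<^sup>\<dagger> ** X) = X\<^sup>\<dagger> ** X ** A" "A\<^sup>\<dagger> ** (X\<^sup>\<dagger> ** X) = X\<^sup>\<dagger> ** X ** A\<^sup>\<dagger>"
  obtains c where "X\<^sup>\<dagger> ** X = mat c"
proof -
  obtain v where v: "norm v = 1" and eig: "X\<^sup>\<dagger> *v (X *v v) = ((norm (X *v v))\<^sup>2) *\<^sub>R v"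
    using max_singular_vector[of X] by blast
  define c :: complex where "c = of_real ((norm (X *v v))\<^sup>2)"
  define M where "M = X\<^sup>\<dagger> ** X - mat c"
  have mat_vec: "mat c *v w = ((norm (X *v v))\<^sup>2) *\<^sub>R w" for w :: "complex^'n"
    unfolding c_def by (simp add: mat_def matrix_vector_mult_def vec_eq_iff
        if_distrib[of "\<lambda>x. x * _"] scaleR_conv_of_real[where 'a = complex] cong: if_cong)
  have Mv: "M *v v = 0"
    by (simp add: M_def matrix_vector_mult_diff_rdistrib mat_vec eig flip: matrix_vector_mul_assoc)
  have M: "A ** M = M ** A" "A\<^sup>\<dagger> ** M = M ** A\<^sup>\<dagger>"
    by (simp_all add: M_def matrix_mult.diff_left matrix_mult.diff_right X mat_mult_commute)
  obtain P where P: "projection_matrix P" and P_iff: "\<And>x. P *v x = x \<longleftrightarrow> M *v x = 0"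
    using kernel_projection[of M] by blast
  have MP: "M *v (P *v x) = 0" for x
    using P unfolding P_iff[symmetric] by (simp add: matrix_vector_mul_assoc projection_matrix_def)
  have "P ** C ** P = C ** P" if "C ** M = M ** C" for C
  proof -
    have "M *v (C *v (P *v x)) = C *v (M *v (P *v x))" for x
      by (simp add: matrix_vector_mul_assoc that flip: matrix_mul_assoc)
        (simp add: matrix_mul_assoc that)
    then have "P *v (C *v (P *v x)) = C *v (P *v x)" for x
      unfolding P_iff by (simp add: MP)
    then show ?thesis
      unfolding matrix_eq by (simp add: matrix_vector_mul_assoc matrix_mul_assoc)
  qed
  then have "P = 0 \<or> P = mat 1"
    using M by (intro irreducible_invariant_projection[OF A P]) auto
  moreover have "P \<noteq> 0"
    using P_iff[of v] Mv v by auto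
  ultimately have "P = mat 1"
    by blast
  then have "M = 0"
    unfolding matrix_eq using P_iff by simp
  then show ?thesis
    using that by (simp add: M_def)
qed

text \<open>Polarization: the Gram matrix of \<open>X + mat z\<close> is scalar for every
  \<open>z\<close>, and comparing \<open>z = 1\<close> and \<open>z = \<i>\<close> with
  \<open>z = 0\<close> recovers \<open>X\<close>.\<close>

lemma irreducible_commutant_scalar:
  fixes A X :: "complex^'n^'n"
  assumes A: "irreducible_matrix A" and X: "A ** X = X ** A" "A\<^sup>\<dagger> ** X = X ** A\<^sup>\<dagger>"
  obtains c where "X = mat c"
proof -
  have X': "A\<^sup>\<dagger> ** X\<^sup>\<dagger> = X\<^sup>\<dagger> ** A\<^sup>\<dagger>" "A ** X\<^sup>\<dagger> = X\<^sup>\<dagger> ** A"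
    using arg_cong[OF X(1), of conj_transpose] arg_cong[OF X(2), of conj_transpose]
    by (simp_all add: conj_transpose_mult)
  have gram: "\<exists>c. Y\<^sup>\<dagger> ** Y = mat c"
    if Y: "A ** Y = Y ** A" "A\<^sup>\<dagger> ** Y = Y ** A\<^sup>\<dagger>" "A ** Y\<^sup>\<dagger> = Y\<^sup>\<dagger> ** A" "A\<^sup>\<dagger> ** Y\<^sup>\<dagger> = Y\<^sup>\<dagger> ** A\<^sup>\<dagger>" for Y
  proof -
    have "A ** (Y\<^sup>\<dagger> ** Y) = Y\<^sup>\<dagger> ** Y ** A" "A\<^sup>\<dagger> ** (Y\<^sup>\<dagger> ** Y) = Y\<^sup>\<dagger> ** Y ** A\<^sup>\<dagger>"
      by (metis Y matrix_mul_assoc)+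
    then show ?thesis
      by (rule irreducible_gram_scalar[OF A]) blast
  qed
  have "\<exists>c. (X + mat z)\<^sup>\<dagger> ** (X + mat z) = mat c" for z
    by (rule gram)
      (simp_all add: conj_transpose_add matrix_mult.add_left matrix_mult.add_right mat_mult_commute X X')
  moreover have "(X + mat z)\<^sup>\<dagger> ** (X + mat z)
      = X\<^sup>\<dagger> ** X + mat z ** X\<^sup>\<dagger> + mat (cnj z) ** X + mat (cnj z * z)" for z
    by (simp add: conj_transpose_add matrix_mult.add_left matrix_mult.add_right
        mat_mult_commute[of "X\<^sup>\<dagger>"] mat_mult_mat algebra_simps)
  ultimately have "\<exists>c. X\<^sup>\<dagger> ** X + mat z ** X\<^sup>\<dagger> + mat (cnj z) ** X + mat (cnj z * z) = mat c" for z
    by simp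
  then obtain f where f: "\<And>z. X\<^sup>\<dagger> ** X + mat z ** X\<^sup>\<dagger> + mat (cnj z) ** X + mat (cnj z * z) = mat (f z)"
    by metis
  have poly: "mat z ** X\<^sup>\<dagger> + mat (cnj z) ** X = mat (f z - f 0 - cnj z * z)" for z
  proof -
    have "mat z ** X\<^sup>\<dagger> + mat (cnj z) ** X = mat (f z) - mat (f 0) - mat (cnj z * z)"
      using f[of z] f[of 0] by (simp add: algebra_simps)
    then show ?thesis
      by (simp only: mat_diff)
  qed
  \<comment> \<open>The scalars equal to X* + X and i(X* - X), so that 2X is the scalar
    \<open>a + \<i> * b\<close>.\<close>
  define a where "a = f 1 - f 0 - 1"
  define b where "b = f \<i> - f 0 - 1"
  have "X $ i $ j = mat ((a + \<i> * b) / 2) $ i $ j" for i j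
  proof -
    have plus: "X\<^sup>\<dagger> $ i $ j + X $ i $ j = mat a $ i $ j"
      using poly[of 1] by (simp add: a_def vec_eq_iff mat_mult_left)
    have minus: "\<i> * X\<^sup>\<dagger> $ i $ j + - \<i> * X $ i $ j = mat b $ i $ j"
      using poly[of \<i>] by (simp add: b_def vec_eq_iff mat_mult_left)
    have "2 * X $ i $ j = mat a $ i $ j + \<i> * mat b $ i $ j"
      unfolding plus[symmetric] minus[symmetric] by (simp add: algebra_simps)
    then show ?thesis
      by (simp add: mat_def mult.commute split: if_splits)
  qed
  then show ?thesis
    by (intro that[of "(a + \<i> * b) / 2"]) (simp add: vec_eq_iff)
qed

section \<open>From Kraus families to a unitary equivalence\<close>

text \<open>One product \<open>V i ** W j\<close> is a nonzero scalar, so \<open>W j\<close> is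
  invertible and every other \<open>W k\<close> is a multiple of it. The second family thus
  collapses to one Kraus operator, which unitality makes unitary.\<close>

lemma mutual_families_unitary:
  fixes A B :: "complex^'n^'n"
  assumes V: "ucp_family I V A B" and W: "ucp_family J W B A"
    and scalar: "\<And>i j. i \<in> I \<Longrightarrow> j \<in> J \<Longrightarrow> \<exists>c. V i ** W j = mat c"
  obtains U where "unitary_matrix U" "B = U\<^sup>\<dagger> ** A ** U"
proof -
  have VW: "ucp_family (I \<times> J) (\<lambda>(i, j). V i ** W j) A A"
    by (rule ucp_family_compose[OF V W])
  have "\<exists>i\<in>I. \<exists>j\<in>J. V i ** W j \<noteq> 0"
  proof (rule ccontr)
    assume "\<not> ?thesis"
    then have "(\<Sum>p\<in>I \<times> J. ((\<lambda>(i, j). V i ** W j) p)\<^sup>\<dagger> ** (\<lambda>(i, j). V i ** W j) p) = 0"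
      by (intro sum.neutral) (auto simp: matrix_mult.zero_right)
    then show False
      using VW mat_1_neq_0[where 'n = 'n] unfolding ucp_family_def by metis
  qed
  then obtain i j where ij: "i \<in> I" "j \<in> J" "V i ** W j \<noteq> 0"
    by blast
  define Y where "Y = W j"
  obtain c where c: "V i ** Y = mat c"
    using scalar[OF ij(1,2)] by (auto simp: Y_def)
  have "c \<noteq> 0"
    using ij(3) c by (auto simp: Y_def mat_def vec_eq_iff)
  have "V i ** (mat (1 / c) ** Y) = mat 1"
    by (metis \<open>c \<noteq> 0\<close> c mat_mult_commute mat_mult_mat matrix_mul_assoc nonzero_divide_eq_eq)
  then have YV: "mat (1 / c) ** Y ** V i = mat 1"
    using matrix_left_right_inverse by blast
  have "\<exists>d. W k = mat d ** Y" if k: "k \<in> J" for k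
  proof -
    obtain e where e: "V i ** W k = mat e"
      using scalar[OF ij(1) k] by blast
    \<comment> \<open>Cancel \<open>V i\<close> with its left inverse; what remains is a scalar
      times \<open>Y\<close>.\<close>
    have "W k = mat (1 / c) ** Y ** (V i ** W k)"
      using YV by (simp add: matrix_mul_assoc)
    also have "\<dots> = mat (e * (1 / c)) ** Y"
      unfolding e mat_mult_commute[of _ e] by (simp add: matrix_mul_assoc mat_mult_mat)
    finally show ?thesis
      by blast
  qed
  then obtain d where d: "\<And>k. k \<in> J \<Longrightarrow> W k = mat (d k) ** Y"
    by metis
  define s where "s = (\<Sum>k\<in>J. (cmod (d k))\<^sup>2)"
  have conjugate: "(\<Sum>k\<in>J. (W k)\<^sup>\<dagger> ** X ** W k) = s *\<^sub>R (Y\<^sup>\<dagger> ** X ** Y)" for X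
  proof -
    have "(W k)\<^sup>\<dagger> ** X ** W k = (cmod (d k))\<^sup>2 *\<^sub>R (Y\<^sup>\<dagger> ** X ** Y)" if "k \<in> J" for k
    proof -
      have "(W k)\<^sup>\<dagger> ** X ** W k = Y\<^sup>\<dagger> ** (mat (cnj (d k)) ** X ** mat (d k)) ** Y"
        unfolding d[OF that] by (simp add: conj_transpose_mult matrix_mul_assoc)
      also have "mat (cnj (d k)) ** X ** mat (d k) = mat (d k * cnj (d k)) ** X"
        unfolding mat_mult_commute[of _ "d k"] by (simp add: matrix_mul_assoc mat_mult_mat)
      also have "\<dots> = (cmod (d k))\<^sup>2 *\<^sub>R X"
        unfolding complex_norm_square[symmetric] by (rule mat_of_real)
      finally show ?thesis
        by (simp add: matrix_mult.scaleR_left matrix_mult.scaleR_right)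
    qed
    then show ?thesis
      by (simp add: s_def scaleR_sum_left)
  qed
  have A: "A = s *\<^sub>R (Y\<^sup>\<dagger> ** B ** Y)" and one: "mat 1 = s *\<^sub>R (Y\<^sup>\<dagger> ** Y)"
    using W conjugate[of B] conjugate[of "mat 1"] by (simp_all add: ucp_family_def)
  have "0 \<le> s"
    by (simp add: s_def sum_nonneg)
  define Z where "Z = sqrt s *\<^sub>R Y"
  have Z: "Z\<^sup>\<dagger> ** X ** Z = s *\<^sub>R (Y\<^sup>\<dagger> ** X ** Y)" for X
    using \<open>0 \<le> s\<close>
    by (simp add: Z_def conj_transpose_scaleR matrix_mult.scaleR_left matrix_mult.scaleR_right)
  have ZZ: "Z\<^sup>\<dagger> ** Z = mat 1"
    unfolding one using Z[of "mat 1"] by simp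
  then have ZZ': "Z ** Z\<^sup>\<dagger> = mat 1"
    using matrix_left_right_inverse by blast
  have "Z ** A ** Z\<^sup>\<dagger> = Z ** (Z\<^sup>\<dagger> ** B ** Z) ** Z\<^sup>\<dagger>"
    using A Z[of B] by simp
  also have "\<dots> = (Z ** Z\<^sup>\<dagger>) ** B ** (Z ** Z\<^sup>\<dagger>)"
    by (simp only: matrix_mul_assoc)
  also have "\<dots> = B"
    by (simp add: ZZ')
  finally have "B = Z\<^sup>\<dagger>\<^sup>\<dagger> ** A ** Z\<^sup>\<dagger>"
    by simp
  then show ?thesis
    using ZZ ZZ' by (intro that[of "Z\<^sup>\<dagger>"]) (simp_all add: unitary_matrix_def)
qed

lemma norm_isometry_mult: "U\<^sup>\<dagger> ** U = mat 1 \<Longrightarrow> norm (U ** X) = norm X"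
  for U :: "complex^'n^'n" and X :: "complex^'m^'n"
  by (simp add: norm_eq_sqrt_inner inner_matrix_mult_left matrix_mul_assoc)

text \<open>Substitute \<open>U ** V\<close> for \<open>V\<close>: left multiplication by
  \<open>U\<close> or its adjoint preserves the Frobenius norm. The reverse inequality comes from
  the same bound for the adjoint of \<open>U\<close>.\<close>

lemma spectral_norm_pencil_unitary_le:
  fixes A H K U :: "complex^'n^'n"
  assumes U: "unitary_matrix U"
  shows "spectral_norm ((U\<^sup>\<dagger> ** A ** U) \<otimes>\<^sub>K H + mat 1 \<otimes>\<^sub>K K)
    \<le> spectral_norm (A \<otimes>\<^sub>K H + mat 1 \<otimes>\<^sub>K K)"
  unfolding spectral_norm_pencil_le_iff[OF spectral_norm_nonneg]
proof
  fix V :: "complex^'n^'n"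
  let ?c = "spectral_norm (A \<otimes>\<^sub>K H + mat 1 \<otimes>\<^sub>K K)"
  have UU: "U\<^sup>\<dagger> ** U = mat 1" "U\<^sup>\<dagger>\<^sup>\<dagger> ** U\<^sup>\<dagger> = mat 1"
    using U by (simp_all add: unitary_matrix_def)
  have "U\<^sup>\<dagger> ** A ** U ** V ** transpose H + V ** transpose K
      = U\<^sup>\<dagger> ** (A ** (U ** V) ** transpose H + (U ** V) ** transpose K)"
    by (simp add: matrix_add_ldistrib matrix_mul_assoc UU)
  then have "norm (U\<^sup>\<dagger> ** A ** U ** V ** transpose H + V ** transpose K)
      = norm (A ** (U ** V) ** transpose H + (U ** V) ** transpose K)"
    by (simp only: norm_isometry_mult[OF UU(2)])
  also have "\<dots> \<le> ?c * norm (U ** V)"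
    using spectral_norm_pencil_le_iff[OF spectral_norm_nonneg, THEN iffD1, OF order_refl] by blast
  finally show "norm (U\<^sup>\<dagger> ** A ** U ** V ** transpose H + V ** transpose K) \<le> ?c * norm V"
    by (simp only: norm_isometry_mult[OF UU(1)])
qed

lemma unitary_conj_transpose: "unitary_matrix U \<Longrightarrow> unitary_matrix U\<^sup>\<dagger>"
  by (simp add: unitary_matrix_def)

theorem theorem2p1:
  fixes A B :: "complex ^ 'n ^ 'n"
  assumes "irreducible_matrix A"
  shows "(\<forall>H K :: complex ^ 'n ^ 'n.
            spectral_norm (A \<otimes>\<^sub>K H + mat 1 \<otimes>\<^sub>K K) = spectral_norm (B \<otimes>\<^sub>K H + mat 1 \<otimes>\<^sub>K K))
     \<longleftrightarrow> (\<exists>U. unitary_matrix U \<and> B = conj_transpose U ** A ** U)"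
proof
  assume norms: "\<forall>H K :: complex ^ 'n ^ 'n.
    spectral_norm (A \<otimes>\<^sub>K H + mat 1 \<otimes>\<^sub>K K) = spectral_norm (B \<otimes>\<^sub>K H + mat 1 \<otimes>\<^sub>K K)"
  \<comment> \<open>Using the norm equality at the transposes of \<open>H\<close> and
    \<open>K\<close> cancels the transposes introduced by vectorization.\<close>
  have pencil: "(\<forall>V. norm (A ** V ** H + V ** K) \<le> c * norm V)
      \<longleftrightarrow> (\<forall>V. norm (B ** V ** H + V ** K) \<le> c * norm V)"
    if "0 \<le> c" for c and H K :: "complex^'n^'n"
    using norms spectral_norm_pencil_le_iff[OF that, of A "transpose H" "transpose K"]
      spectral_norm_pencil_le_iff[OF that, of B "transpose H" "transpose K"]
    by (simp add: transpose_transpose)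
  obtain I :: "nat set" and V where V: "ucp_family I V A B"
    by (rule ucp_family_exists[of A B]) (use pencil in blast)+
  obtain J :: "nat set" and W where W: "ucp_family J W B A"
    by (rule ucp_family_exists[of B A]) (use pencil in blast)+
  have "\<exists>c. V i ** W j = mat c" if "i \<in> I" "j \<in> J" for i j
  proof -
    have "A ** (V i ** W j) = V i ** W j ** A" "A\<^sup>\<dagger> ** (V i ** W j) = V i ** W j ** A\<^sup>\<dagger>"
      using irreducible_family_commutes[OF assms ucp_family_compose[OF V W], of "(i, j)"] that
      by simp_all
    then show ?thesis
      by (rule irreducible_commutant_scalar[OF assms]) blast
  qed
  then show "\<exists>U. unitary_matrix U \<and> B = U\<^sup>\<dagger> ** A ** U"
    using mutual_families_unitary[OF V W] by metis
next
  assume "\<exists>U. unitary_matrix U \<and> B = U\<^sup>\<dagger> ** A ** U"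
  then obtain U where U: "unitary_matrix U" and B: "B = U\<^sup>\<dagger> ** A ** U"
    by blast
  have "U\<^sup>\<dagger>\<^sup>\<dagger> ** B ** U\<^sup>\<dagger> = (U ** U\<^sup>\<dagger>) ** A ** (U ** U\<^sup>\<dagger>)"
    unfolding B by (simp add: matrix_mul_assoc)
  then have A: "A = U\<^sup>\<dagger>\<^sup>\<dagger> ** B ** U\<^sup>\<dagger>"
    using U by (simp add: unitary_matrix_def)
  show "\<forall>H K :: complex ^ 'n ^ 'n.
    spectral_norm (A \<otimes>\<^sub>K H + mat 1 \<otimes>\<^sub>K K) = spectral_norm (B \<otimes>\<^sub>K H + mat 1 \<otimes>\<^sub>K K)"
    using spectral_norm_pencil_unitary_le[OF U, of A]
      spectral_norm_pencil_unitary_le[OF unitary_conj_transpose[OF U], of B]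
    unfolding A[symmetric] B[symmetric] by (intro allI antisym)
qed

end
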